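(* For any metric spaces $X$ and $Y$ that are zero-dimensional (i.e. $\dim X=\dim Y=0$), we have $$d_{GH}^c(X,Y)=d_{GH}(X,Y).$$
   Context: All metric spaces are non-empty; $|xx'|$ denotes the distance between points $x,x'$. For maps $f\colon X\to Y$ and $g\colon Y\to X$ put $$\operatorname{dis} f=\sup_{x,x'\in X}\bigl||xx'|-|f(x)f(x')|\bigr|,\qquad \operatorname{codis}(f,g)=\sup_{x\in X,\,y\in Y}\bigl||x\,g(y)|-|f(x)\,y|\bigr|$$ ($\operatorname{dis} g$ is defined analogously). The Gromov--Hausdorff distance $d_{GH}(X,Y)$ equals $\frac12\inf\max\{\operatorname{dis} f,\operatorname{dis} g,\operatorname{codis}(f,g)\}$ over all (not necessarily continuous) maps $f\colon X\to Y$, $g\colon Y\to X$; the continuous Gromov--Hausdorff distance $d^c_{GH}(X,Y)\in[0,\infty]$ is given by the same formula with the infimum over all continuous maps $f\colon X\to Y$, $g\colon Y\to X$. Here $\dim$ is the Lebesgue covering dimension; a non-empty space $X$ is zero-dimensional, $\dim X=0$, if every finite open cover of $X$ has a refinement that is a partition of $X$ into open sets. *)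

theory Defs
  imports "HOL-Analysis.Analysis" "HOL-Library.Disjoint_Sets"
begin

text \<open>Suprema and infima are taken in \<^typ>\<open>ennreal\<close>, so unbounded distortions have the value
  \<open>\<infinity>\<close> and an infimum over an empty family would be \<open>\<infinity>\<close>.\<close>

definition distortion :: "'a metric \<Rightarrow> 'b metric \<Rightarrow> ('a \<Rightarrow> 'b) \<Rightarrow> ennreal" where
  "distortion X Y f =
     (SUP x\<in>mspace X. SUP x'\<in>mspace X. ennreal \<bar>mdist X x x' - mdist Y (f x) (f x')\<bar>)"

definition codistortion :: "'a metric \<Rightarrow> 'b metric \<Rightarrow> ('a \<Rightarrow> 'b) \<Rightarrow> ('b \<Rightarrow> 'a) \<Rightarrow> ennreal" where
  "codistortion X Y f g =
     (SUP x\<in>mspace X. SUP y\<in>mspace Y. ennreal \<bar>mdist X x (g y) - mdist Y (f x) y\<bar>)"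

definition GH_dist :: "'a metric \<Rightarrow> 'b metric \<Rightarrow> ennreal" where
  "GH_dist X Y =
     (INF f\<in>mspace X \<rightarrow> mspace Y. INF g\<in>mspace Y \<rightarrow> mspace X.
        max (distortion X Y f) (max (distortion Y X g) (codistortion X Y f g))) / 2"

definition continuous_GH_dist :: "'a metric \<Rightarrow> 'b metric \<Rightarrow> ennreal" where
  "continuous_GH_dist X Y =
     (INF f\<in>{f. continuous_map (mtopology_of X) (mtopology_of Y) f}.
      INF g\<in>{g. continuous_map (mtopology_of Y) (mtopology_of X) g}.
        max (distortion X Y f) (max (distortion Y X g) (codistortion X Y f g))) / 2"

text \<open>Covering dimension zero, including non-emptiness. The refining partition need not be
  finite.\<close>

definition zero_dimensional_space :: "'a topology \<Rightarrow> bool" where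
  "zero_dimensional_space T \<longleftrightarrow>
     topspace T \<noteq> {} \<and>
     (\<forall>\<U>. finite \<U> \<and> (\<forall>U\<in>\<U>. openin T U) \<and> \<Union>\<U> = topspace T \<longrightarrow>
        (\<exists>\<P>. partition_on (topspace T) \<P> \<and> (\<forall>P\<in>\<P>. openin T P) \<and>
             (\<forall>P\<in>\<P>. \<exists>U\<in>\<U>. P \<subseteq> U)))"

end

theory Submission
  imports Defs
begin

text \<open>It suffices to approximate the identity of a zero-dimensional metric space uniformly by
  locally constant maps \<open>p\<close>: composing arbitrary \<open>f\<close> and \<open>g\<close> with such maps makes them continuous
  and increases each distortion and the codistortion by at most \<open>2\<epsilon>\<close>.

  To find \<open>p\<close>, well-order the space and let \<open>c x\<close> be the least centre of an \<open>\<epsilon>\<close>-ball containing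
  \<open>x\<close>. On the set \<open>A n\<close> of those \<open>x\<close> whose \<open>1/(n+1)\<close>-ball stays inside the \<open>\<epsilon>\<close>-ball
  around \<open>c x\<close>, distinct values of \<open>c\<close> are taken at distance at least \<open>1/(n+1)\<close> (as in Stone's
  proof of paracompactness), so \<open>c\<close> extends locally constantly to a neighbourhood of \<open>A n\<close>. Clopen
  sets between the closure of \<open>A n\<close> and this neighbourhood allow the extensions for all \<open>n\<close> to be
  glued.\<close>

section \<open>Clopen separation and locally constant approximations of the identity\<close>

lemma zero_dimensional_clopen_between:
  assumes T: "zero_dimensional_space T" and "closedin T C" "openin T W" "C \<subseteq> W"
  obtains G where "openin T G" "closedin T G" "C \<subseteq> G" "G \<subseteq> W"
proof -
  have W: "W \<subseteq> topspace T" and C: "C \<subseteq> topspace T"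
    using assms by (auto dest: openin_subset closedin_subset)
  have "finite {W, topspace T - C} \<and> (\<forall>U\<in>{W, topspace T - C}. openin T U) \<and>
      \<Union>{W, topspace T - C} = topspace T"
    using assms W C by auto
  then have "\<exists>P. partition_on (topspace T) P \<and> (\<forall>p\<in>P. openin T p) \<and>
      (\<forall>p\<in>P. \<exists>U\<in>{W, topspace T - C}. p \<subseteq> U)"
    by (rule T[unfolded zero_dimensional_space_def, THEN conjunct2, rule_format])
  then obtain P where P: "partition_on (topspace T) P" "\<forall>p\<in>P. openin T p"
    "\<forall>p\<in>P. \<exists>U\<in>{W, topspace T - C}. p \<subseteq> U"
    by (elim exE conjE)
  \<comment> \<open>The discarded pieces make up the complement of \<open>G\<close>, which is
    therefore open. A piece meeting \<open>C\<close> cannot lie in \<open>topspace T - C\<close>, so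
    it lies in \<open>W\<close> and is kept.\<close>
  define G where "G = \<Union>{p\<in>P. p \<subseteq> W}"
  have cover: "\<Union>P = topspace T" and disj: "disjoint P"
    using P(1) by (auto simp: partition_on_def)
  have "topspace T - G = \<Union>{p\<in>P. \<not> p \<subseteq> W}"
  proof -
    have "p = q" if "p \<in> P" "q \<in> P" "x \<in> p" "x \<in> q" for p q x
      using disj that by (auto simp: disjoint_def)
    then show ?thesis unfolding G_def cover[symmetric] by blast
  qed
  moreover have "openin T (\<Union>{p\<in>P. \<not> p \<subseteq> W})"
    using P(2) by (intro openin_Union) auto
  moreover have openG: "openin T G"
    unfolding G_def using P(2) by (intro openin_Union) auto
  ultimately have "closedin T G"
    by (simp add: closedin_def openin_subset)
  moreover have "C \<subseteq> G"
  proof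
    fix x assume "x \<in> C"
    with C cover obtain p where "p \<in> P" "x \<in> p" by blast
    with P(3) \<open>x \<in> C\<close> show "x \<in> G" unfolding G_def by blast
  qed
  moreover have "G \<subseteq> W" unfolding G_def by auto
  ultimately show ?thesis using openG that by blast
qed

lemma (in Metric_space) zero_dimensional_locally_constant_approximation:
  assumes zd: "zero_dimensional_space mtopology" and "\<epsilon> > 0"
  obtains p where "p \<in> M \<rightarrow> M" "\<And>x. x \<in> M \<Longrightarrow> d (p x) x < \<epsilon>"
    "\<And>x. x \<in> M \<Longrightarrow> \<exists>U. openin mtopology U \<and> x \<in> U \<and> (\<forall>y\<in>U. p y = p x)"
proof -
  obtain r where r: "well_order_on M r" using well_order_on by blast
  then have wf: "wf (r - Id)" and tot: "total_on M r"
    by (auto simp: well_order_on_def linear_order_on_def)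
  have "\<exists>a. a \<in> M \<and> d a x < \<epsilon> \<and> (\<forall>b. (b, a) \<in> r - Id \<longrightarrow> \<not> (b \<in> M \<and> d b x < \<epsilon>))"
    if "x \<in> M" for x
  proof -
    have "x \<in> {a\<in>M. d a x < \<epsilon>}" using that \<open>\<epsilon> > 0\<close> by simp
    from wfE_min[OF wf this] show ?thesis by (metis (no_types, lifting) mem_Collect_eq)
  qed
  then obtain c where c: "\<And>x. x \<in> M \<Longrightarrow> c x \<in> M" "\<And>x. x \<in> M \<Longrightarrow> d (c x) x < \<epsilon>"
    "\<And>x b. \<lbrakk>x \<in> M; (b, c x) \<in> r - Id; b \<in> M\<rbrakk> \<Longrightarrow> \<not> d b x < \<epsilon>"
    by metis
  \<comment> \<open>The factor 3 leaves room: two points of \<open>A n\<close> whose balls of radius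
    \<open>\<delta> n\<close> share a point are less than \<open>3 * \<delta> n\<close> apart, so
    \<open>sep\<close> applies to them.\<close>
  define \<delta> where "\<delta> n = inverse (real (Suc n)) / 3" for n
  have \<delta>: "\<delta> n > 0" for n by (simp add: \<delta>_def)
  define A where "A n = {x\<in>M. \<forall>y\<in>M. d x y < 3 * \<delta> n \<longrightarrow> d (c x) y < \<epsilon>}" for n
  have AM: "A n \<subseteq> M" for n by (auto simp: A_def)
  \<comment> \<open>Each of the balls around \<open>c x\<close> and \<open>c y\<close> contains both
    points. If the centres differed, the smaller one would contradict minimality of the
    other.\<close>
  have sep: "c x = c y" if "x \<in> A n" "y \<in> A n" "d x y < 3 * \<delta> n" for x y n
  proof (rule ccontr)
    have xy: "x \<in> M" "y \<in> M" using that AM by auto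
    assume "c x \<noteq> c y"
    with tot c(1) xy have "(c x, c y) \<in> r - Id \<or> (c y, c x) \<in> r - Id"
      by (auto simp: total_on_def)
    moreover have "d (c x) y < \<epsilon>" "d (c y) x < \<epsilon>"
      using that xy by (auto simp: A_def commute)
    ultimately show False using c xy by blast
  qed
  define W where "W n = (\<Union>x\<in>A n. mball x (\<delta> n))" for n
  have "\<exists>G. openin mtopology G \<and> closedin mtopology G \<and> mtopology closure_of A n \<subseteq> G \<and> G \<subseteq> W n"
    for n
  proof -
    have "openin mtopology (W n)" unfolding W_def by auto
    moreover have "mtopology closure_of A n \<subseteq> W n"
      unfolding W_def metric_closure_of using \<delta>[of n] by (auto simp: commute)
    ultimately show ?thesis
      by (rule zero_dimensional_clopen_between[OF zd closedin_closure_of]) blast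
  qed
  then obtain G where G: "\<And>n. openin mtopology (G n)" "\<And>n. closedin mtopology (G n)"
    "\<And>n. mtopology closure_of A n \<subseteq> G n" "\<And>n. G n \<subseteq> W n" by metis
  have AG: "A n \<subseteq> G n" for n
    using G(3)[of n] AM[of n] closure_of_subset[of "A n" mtopology] by auto
  \<comment> \<open>As \<open>d (c x) x < \<epsilon>\<close> is strict, \<open>x\<close> lies in
    \<open>A n\<close> as soon as \<open>1/(n+1)\<close> is below the gap
    \<open>\<epsilon> - d (c x) x\<close>.\<close>
  have ex: "\<exists>n. x \<in> G n" if x: "x \<in> M" for x
  proof -
    obtain n where n: "inverse (real (Suc n)) < \<epsilon> - d (c x) x"
      using reals_Archimedean[of "\<epsilon> - d (c x) x"] c(2)[OF x] by auto
    have "d (c x) y < \<epsilon>" if "y \<in> M" "d x y < 3 * \<delta> n" for y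
      using triangle[of "c x" x y] c(1) n that x by (auto simp: \<delta>_def)
    then have "x \<in> A n" using x by (auto simp: A_def)
    then show ?thesis using AG by blast
  qed
  \<comment> \<open>Taking the least index makes the sets \<open>G n\<close> disjoint: the level
    sets of \<open>N\<close> in \<open>M\<close> are \<open>G n\<close> minus finitely many clopen
    sets, hence open.\<close>
  define N where "N x = (LEAST n. x \<in> G n)" for x
  have N: "x \<in> G (N x)" if "x \<in> M" for x
    unfolding N_def using ex[OF that] by (rule LeastI_ex)
  have "\<exists>a. a \<in> A (N x) \<and> d a x < \<delta> (N x)" if "x \<in> M" for x
    using N[OF that] G(4)[of "N x"] by (force simp: W_def)
  \<comment> \<open>The choice of \<open>a x\<close> may jump from point to point; by
    \<open>sep\<close> the value \<open>c (a x)\<close> does not.\<close>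
  then obtain a where a: "\<And>x. x \<in> M \<Longrightarrow> a x \<in> A (N x)" "\<And>x. x \<in> M \<Longrightarrow> d (a x) x < \<delta> (N x)"
    by metis
  show ?thesis
  proof (rule that[of "\<lambda>x. c (a x)"])
    show "(\<lambda>x. c (a x)) \<in> M \<rightarrow> M" using a(1) AM c(1) by blast
  next
    fix x assume "x \<in> M"
    then show "d (c (a x)) x < \<epsilon>"
      using a(1)[of x] a(2)[of x] \<delta>[of "N x"] by (auto simp: A_def)
  next
    fix x assume x: "x \<in> M"
    \<comment> \<open>Removing the earlier \<open>G m\<close> forces \<open>N y = N x\<close> on
      \<open>U\<close>; the ball puts \<open>a x\<close> and \<open>a y\<close> within
      \<open>2 * \<delta> (N x)\<close> of each other.\<close>
    define U where "U = (G (N x) - (\<Union>m<N x. G m)) \<inter> mball (a x) (\<delta> (N x))"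
    have "openin mtopology U"
      unfolding U_def by (intro openin_Int openin_diff closedin_Union) (use G in auto)
    moreover have "x \<in> U"
    proof -
      have "x \<notin> G m" if "m < N x" for m
        using that unfolding N_def by (rule not_less_Least)
      moreover have "a x \<in> M" using a(1)[OF x] AM by blast
      ultimately show ?thesis using N[OF x] a(2)[OF x] x by (auto simp: U_def)
    qed
    moreover have "c (a y) = c (a x)" if "y \<in> U" for y
    proof -
      have y: "y \<in> M" "d (a x) y < \<delta> (N x)" using that by (auto simp: U_def)
      have "N y = N x"
        unfolding N_def[of y]
      proof (rule Least_equality)
        show "y \<in> G (N x)" using that by (simp add: U_def)
        show "N x \<le> m" if "y \<in> G m" for m
          using that \<open>y \<in> U\<close> by (auto simp: U_def not_less[symmetric])
      qed
      moreover have "a y \<in> M" "a x \<in> M" using a(1) AM x y by auto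
      then have "d (a y) (a x) \<le> d (a y) y + d (a x) y"
        using triangle[of "a y" y "a x"] y by (simp add: commute)
      ultimately show ?thesis
        using a(1)[OF x] a[OF y(1)] y(2) \<delta>[of "N x"] by (intro sep[of _ "N x"]) auto
    qed
    ultimately show "\<exists>U. openin mtopology U \<and> x \<in> U \<and> (\<forall>y\<in>U. c (a y) = c (a x))" by blast
  qed
qed

lemma locally_constant_imp_continuous_map:
  assumes "f \<in> topspace S \<rightarrow> topspace T"
    and "\<And>x. x \<in> topspace S \<Longrightarrow> \<exists>U. openin S U \<and> x \<in> U \<and> (\<forall>y\<in>U. f y = f x)"
  shows "continuous_map S T f"
  unfolding continuous_map_def
proof (intro conjI allI impI)
  fix V assume "openin T V"
  show "openin S {x \<in> topspace S. f x \<in> V}"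
  proof (subst openin_subopen, intro ballI)
    fix x assume x: "x \<in> {x \<in> topspace S. f x \<in> V}"
    with assms(2) obtain U where U: "openin S U" "x \<in> U" "\<forall>y\<in>U. f y = f x" by blast
    have "U \<subseteq> {x \<in> topspace S. f x \<in> V}"
    proof
      fix y assume "y \<in> U"
      with U(3) have "f y = f x" by blast
      with x \<open>y \<in> U\<close> show "y \<in> {x \<in> topspace S. f x \<in> V}"
        using openin_subset[OF U(1)] by auto
    qed
    with U show "\<exists>U. openin S U \<and> x \<in> U \<and> U \<subseteq> {x \<in> topspace S. f x \<in> V}" by blast
  qed
qed (use assms(1) in auto)

text \<open>Local constancy of \<open>p\<close> passes to \<open>f (p x)\<close> for every
  \<open>f\<close>, however discontinuous. This is the only form in which it is needed
  later.\<close>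

lemma zero_dimensional_locally_constant_approximation_mspace:
  assumes "zero_dimensional_space (mtopology_of X)" and "\<epsilon> > 0"
  obtains p where "p \<in> mspace X \<rightarrow> mspace X" "\<And>x. x \<in> mspace X \<Longrightarrow> mdist X (p x) x < \<epsilon>"
    "\<And>(Y :: 'b metric) f. f \<in> mspace X \<rightarrow> mspace Y \<Longrightarrow>
      continuous_map (mtopology_of X) (mtopology_of Y) (\<lambda>x. f (p x))"
proof -
  interpret X: Metric_space "mspace X" "mdist X" by simp
  obtain p where p: "p \<in> mspace X \<rightarrow> mspace X" "\<And>x. x \<in> mspace X \<Longrightarrow> mdist X (p x) x < \<epsilon>"
    "\<And>x. x \<in> mspace X \<Longrightarrow> \<exists>U. openin X.mtopology U \<and> x \<in> U \<and> (\<forall>y\<in>U. p y = p x)"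
    using X.zero_dimensional_locally_constant_approximation assms
    unfolding mtopology_of_def by metis
  show ?thesis
  proof (rule that[OF p(1,2)])
    fix Y :: "'b metric" and f assume f: "f \<in> mspace X \<rightarrow> mspace Y"
    show "continuous_map (mtopology_of X) (mtopology_of Y) (\<lambda>x. f (p x))"
    proof (rule locally_constant_imp_continuous_map)
      show "(\<lambda>x. f (p x)) \<in> topspace (mtopology_of X) \<rightarrow> topspace (mtopology_of Y)"
        using f p(1) by auto
      show "\<exists>U. openin (mtopology_of X) U \<and> x \<in> U \<and> (\<forall>y\<in>U. f (p y) = f (p x))"
        if "x \<in> topspace (mtopology_of X)" for x
      proof -
        from that have "x \<in> mspace X" by simp
        from p(3)[OF this] show ?thesis unfolding mtopology_of_def by metis
      qed
    qed
  qed
qed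

section \<open>Effect of small displacements on distortion and codistortion\<close>

lemma mdist_diff_le:
  assumes "x \<in> mspace X" "x' \<in> mspace X" "y \<in> mspace X" "y' \<in> mspace X"
  shows "\<bar>mdist X x y - mdist X x' y'\<bar> \<le> mdist X x' x + mdist X y' y"
proof -
  interpret X: Metric_space "mspace X" "mdist X" by simp
  show ?thesis
    using X.triangle[OF assms(1,2,3)] X.triangle[OF assms(2,4,3)] X.triangle[OF assms(2,1,4)]
      X.triangle[OF assms(1,3,4)] X.commute[of x x'] X.commute[of y y']
    by linarith
qed

text \<open>Compare the pair \<open>x\<close>, \<open>x'\<close> with \<open>p x\<close>,
  \<open>p x'\<close>: the distance in \<open>Y\<close> is the same for both, and the distance in
  \<open>X\<close> changes by at most \<open>\<epsilon>\<close> per endpoint.\<close>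

lemma distortion_compose_le:
  assumes "p \<in> mspace X \<rightarrow> mspace X" and p: "\<And>x. x \<in> mspace X \<Longrightarrow> mdist X (p x) x \<le> \<epsilon>"
    and "\<epsilon> \<ge> 0"
  shows "distortion X Y (\<lambda>x. f (p x)) \<le> distortion X Y f + ennreal (2 * \<epsilon>)"
  unfolding distortion_def[of X Y "\<lambda>x. f (p x)"]
proof (intro SUP_least)
  fix x x' assume x: "x \<in> mspace X" "x' \<in> mspace X"
  then have px: "p x \<in> mspace X" "p x' \<in> mspace X" using assms by auto
  let ?t = "\<bar>mdist X (p x) (p x') - mdist Y (f (p x)) (f (p x'))\<bar>"
  have "\<bar>mdist X x x' - mdist Y (f (p x)) (f (p x'))\<bar> \<le> ?t + 2 * \<epsilon>"
    using mdist_diff_le[OF x(1) px(1) x(2) px(2)] p[OF x(1)] p[OF x(2)] by linarith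
  then have "ennreal \<bar>mdist X x x' - mdist Y (f (p x)) (f (p x'))\<bar> \<le> ennreal ?t + ennreal (2 * \<epsilon>)"
    using \<open>\<epsilon> \<ge> 0\<close> by (simp flip: ennreal_plus)
  also have "ennreal ?t \<le> distortion X Y f"
    unfolding distortion_def using px by (meson SUP_upper2 order_refl)
  finally show "ennreal \<bar>mdist X x x' - mdist Y (f (p x)) (f (p x'))\<bar>
      \<le> distortion X Y f + ennreal (2 * \<epsilon>)" by simp
qed

text \<open>Compare \<open>x\<close>, \<open>y\<close> with \<open>p x\<close>, \<open>q y\<close>:
  each of the two distances has one endpoint moved, by at most \<open>\<epsilon>\<close>, while the
  other stays fixed.\<close>

lemma codistortion_compose_le:
  assumes "p \<in> mspace X \<rightarrow> mspace X" and p: "\<And>x. x \<in> mspace X \<Longrightarrow> mdist X (p x) x \<le> \<epsilon>"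
    and "q \<in> mspace Y \<rightarrow> mspace Y" and q: "\<And>y. y \<in> mspace Y \<Longrightarrow> mdist Y (q y) y \<le> \<epsilon>"
    and f: "f \<in> mspace X \<rightarrow> mspace Y" and g: "g \<in> mspace Y \<rightarrow> mspace X" and "\<epsilon> \<ge> 0"
  shows "codistortion X Y (\<lambda>x. f (p x)) (\<lambda>y. g (q y)) \<le> codistortion X Y f g + ennreal (2 * \<epsilon>)"
  unfolding codistortion_def[of X Y "\<lambda>x. f (p x)"]
proof (intro SUP_least)
  fix x y assume xy: "x \<in> mspace X" "y \<in> mspace Y"
  then have pq: "p x \<in> mspace X" "q y \<in> mspace Y" using assms by auto
  then have fg: "f (p x) \<in> mspace Y" "g (q y) \<in> mspace X" using f g by auto
  let ?t = "\<bar>mdist X (p x) (g (q y)) - mdist Y (f (p x)) (q y)\<bar>"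
  \<comment> \<open>These are the displacements of the fixed endpoints in the two uses of
    \<open>mdist_diff_le\<close> below.\<close>
  have "mdist X (g (q y)) (g (q y)) = 0" "mdist Y (f (p x)) (f (p x)) = 0"
    using fg by simp_all
  then have "\<bar>mdist X x (g (q y)) - mdist Y (f (p x)) y\<bar> \<le> ?t + 2 * \<epsilon>"
    using mdist_diff_le[OF xy(1) pq(1) fg(2) fg(2)] mdist_diff_le[OF fg(1) fg(1) xy(2) pq(2)]
      p[OF xy(1)] q[OF xy(2)]
    by linarith
  then have "ennreal \<bar>mdist X x (g (q y)) - mdist Y (f (p x)) y\<bar> \<le> ennreal ?t + ennreal (2 * \<epsilon>)"
    using \<open>\<epsilon> \<ge> 0\<close> by (simp flip: ennreal_plus)
  also have "ennreal ?t \<le> codistortion X Y f g"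
    unfolding codistortion_def using pq by (meson SUP_upper2 order_refl)
  finally show "ennreal \<bar>mdist X x (g (q y)) - mdist Y (f (p x)) y\<bar>
      \<le> codistortion X Y f g + ennreal (2 * \<epsilon>)" by simp
qed

section \<open>Comparison of the two infima\<close>

theorem corollary4p6:
  fixes X :: "'a metric" and Y :: "'b metric"
  assumes "zero_dimensional_space (mtopology_of X)"
    and "zero_dimensional_space (mtopology_of Y)"
  shows "continuous_GH_dist X Y = GH_dist X Y"
proof -
  define m where
    "m f g = max (distortion X Y f) (max (distortion Y X g) (codistortion X Y f g))" for f g
  define C where "C = {f. continuous_map (mtopology_of X) (mtopology_of Y) f}"
  define D where "D = {g. continuous_map (mtopology_of Y) (mtopology_of X) g}"
  have "(INF f\<in>C. INF g\<in>D. m f g) \<le> m f g"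
    if f: "f \<in> mspace X \<rightarrow> mspace Y" and g: "g \<in> mspace Y \<rightarrow> mspace X" for f g
  proof (rule ennreal_le_epsilon)
    fix e :: real assume "e > 0"
    \<comment> \<open>Precomposition costs twice the displacement, so displacements below
      \<open>e / 2\<close> keep the total loss at \<open>e\<close>.\<close>
    then have "e / 2 > 0" by simp
    obtain p where p: "p \<in> mspace X \<rightarrow> mspace X" "\<And>x. x \<in> mspace X \<Longrightarrow> mdist X (p x) x < e / 2"
      "(\<lambda>x. f (p x)) \<in> C"
      using zero_dimensional_locally_constant_approximation_mspace[OF assms(1) \<open>e / 2 > 0\<close>] f
      unfolding C_def by (metis mem_Collect_eq)
    obtain q where q: "q \<in> mspace Y \<rightarrow> mspace Y" "\<And>y. y \<in> mspace Y \<Longrightarrow> mdist Y (q y) y < e / 2"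
      "(\<lambda>y. g (q y)) \<in> D"
      using zero_dimensional_locally_constant_approximation_mspace[OF assms(2) \<open>e / 2 > 0\<close>] g
      unfolding D_def by (metis mem_Collect_eq)
    have "(INF f\<in>C. INF g\<in>D. m f g) \<le> m (\<lambda>x. f (p x)) (\<lambda>y. g (q y))"
      using p(3) q(3) by (meson INF_lower2 order_refl)
    also have "\<dots> \<le> m f g + ennreal e"
    proof -
      have "distortion X Y (\<lambda>x. f (p x)) \<le> distortion X Y f + ennreal e"
        using distortion_compose_le[of p X "e / 2" Y f] p \<open>e > 0\<close> by (simp add: less_imp_le)
      moreover have "distortion Y X (\<lambda>y. g (q y)) \<le> distortion Y X g + ennreal e"
        using distortion_compose_le[of q Y "e / 2" X g] q \<open>e > 0\<close> by (simp add: less_imp_le)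
      moreover have "codistortion X Y (\<lambda>x. f (p x)) (\<lambda>y. g (q y)) \<le> codistortion X Y f g + ennreal e"
        using codistortion_compose_le[of p X "e / 2" q Y f g] p q f g \<open>e > 0\<close>
        by (simp add: less_imp_le)
      ultimately show ?thesis
        unfolding m_def by (auto elim!: order_trans intro!: add_right_mono simp: le_max_iff_disj)
    qed
    finally show "(INF f\<in>C. INF g\<in>D. m f g) \<le> m f g + ennreal e" .
  qed
  then have "(INF f\<in>C. INF g\<in>D. m f g)
      \<le> (INF f\<in>mspace X \<rightarrow> mspace Y. INF g\<in>mspace Y \<rightarrow> mspace X. m f g)"
    by (intro INF_greatest)
  \<comment> \<open>The reverse inequality: the continuous maps are among all maps, so their infimum
    is no smaller.\<close>
  moreover have "C \<subseteq> mspace X \<rightarrow> mspace Y" "D \<subseteq> mspace Y \<rightarrow> mspace X"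
    unfolding C_def D_def by (auto simp: continuous_map_def)
  then have "(INF f\<in>mspace X \<rightarrow> mspace Y. INF g\<in>mspace Y \<rightarrow> mspace X. m f g)
      \<le> (INF f\<in>C. INF g\<in>D. m f g)"
    by (intro INF_superset_mono) auto
  ultimately have "(INF f\<in>C. INF g\<in>D. m f g)
      = (INF f\<in>mspace X \<rightarrow> mspace Y. INF g\<in>mspace Y \<rightarrow> mspace X. m f g)"
    by (rule antisym)
  then show ?thesis
    unfolding continuous_GH_dist_def GH_dist_def m_def C_def D_def by simp
qed

end
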